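(* Let $q(n)=an^2+bn+c$ be a quadratic function with real coefficients such that $q(n)>0$ for all $n=1,2,\ldots$, normalized so that $$u_0:=\sum_{n=1}^\infty\frac1{q(n)}=1,$$ and let $u_k:=\sum_{n=1}^\infty \dfrac{n^{-k}}{q(n)}$ for $k\ge1$. Let $r_1,r_2\in\mathbb C$ be the two roots of $q$, so $q(z)=a(z-r_1)(z-r_2)$. Then $(u_k)_{k\ge 0}$ is a decreasing, positive recurrent renewal sequence, with $$\lim_{k\to\infty}u_k=\frac1{q(1)}.$$ The corresponding distribution of an i.i.d. sequence of positive integer valued random variables $Y_1,Y_2,\ldots$ with $\mathbb P(Y_1+\cdots+Y_m=k\text{ for some }m)=u_k$ has mean and variance $$\mathbb E(Y_1)=q(1),$$ $$\operatorname{Var}(Y_1)=(4-q(1))\,a-q(-1)+q(1)\bigl(c+2\gamma+\psi(1-r_1)+\psi(1-r_2)\bigr),$$ and probability generating function, for $|z|<1$, $$F(z):=\mathbb E(z^{Y_1})=1-\frac1{U(z)},\qquad\text{where } U(z):=\sum_{k=0}^\infty u_kz^k=\frac{c\,u_0+(b\,u_0+c\,u_1)z+G(z)}{q(z)},\quad G(z):=-z\bigl(\gamma+\psi(1-z)\bigr),$$ the quotient for $U(z)$ being understood by analytic continuation at any zero of $q$ in $|z|<1$.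
   Context: $\gamma$ is the Euler constant and $\psi(x)=\Gamma'(x)/\Gamma(x)$ is the digamma function. For $|z|<1$, $G(z)=\sum_{n=2}^\infty\zeta(n)z^n$, with $\zeta$ the Riemann zeta function. A sequence $(u_k)_{k\ge0}$ with $u_0=1$ is a renewal sequence if there is a sequence $(f_k)_{k\ge1}$ with $f_k\ge0$ and $\sum_kf_k\le1$ such that $u_k=f_k+f_{k-1}u_1+\cdots+f_1u_{k-1}$ for all $k\ge1$. It is positive recurrent if $\sum_kf_k=1$ and $\sum_kkf_k<\infty$; in that case the $Y_i$ are i.i.d. with $\mathbb P(Y_1=k)=f_k$, and $u_k$ is the probability that $k$ is one of the partial sums $Y_1+\cdots+Y_m$ (with $m\ge 0$, the empty sum being $0$). *)

theory Defs
  imports "HOL-Probability.Probability" "HOL-Complex_Analysis.Complex_Analysis"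
begin

definition quad :: "real \<Rightarrow> real \<Rightarrow> real \<Rightarrow> 'a::real_field \<Rightarrow> 'a" where
  "quad a b c x = of_real a * x\<^sup>2 + of_real b * x + of_real c"

text \<open>The series defining \<open>u\<close> is over \<open>n \<ge> 1\<close>, hence the shift by \<^const>\<open>Suc\<close>.\<close>

definition quad_seq :: "real \<Rightarrow> real \<Rightarrow> real \<Rightarrow> nat \<Rightarrow> real" where
  "quad_seq a b c k = (\<Sum>n. (1 / real (Suc n)) ^ k / quad a b c (real (Suc n)))"

text \<open>Only the values \<open>f k\<close> with \<open>k \<ge> 1\<close> matter; the value \<open>f 0\<close> is ignored throughout.\<close>

definition renewal_law :: "(nat \<Rightarrow> real) \<Rightarrow> (nat \<Rightarrow> real) \<Rightarrow> bool" where
  "renewal_law f u \<longleftrightarrow>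
     (\<forall>k\<ge>1. 0 \<le> f k) \<and>
     summable (\<lambda>k. f (Suc k)) \<and> (\<Sum>k. f (Suc k)) \<le> 1 \<and>
     u 0 = 1 \<and> (\<forall>k\<ge>1. u k = (\<Sum>j=1..k. f j * u (k - j)))"

definition renewal_sequence :: "(nat \<Rightarrow> real) \<Rightarrow> bool" where
  "renewal_sequence u \<longleftrightarrow> (\<exists>f. renewal_law f u)"

definition positive_recurrent :: "(nat \<Rightarrow> real) \<Rightarrow> bool" where
  "positive_recurrent u \<longleftrightarrow>
     (\<exists>f. renewal_law f u \<and> (\<lambda>k. f (Suc k)) sums 1 \<and>
          summable (\<lambda>k. real (Suc k) * f (Suc k)))"

text \<open>\<open>Y 1, Y 2, \<dots>\<close> are i.i.d. positive integer valued random variables on \<open>M\<close> whose partial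
  sums hit \<open>k\<close> with probability \<open>u k\<close>; \<open>m = 0\<close> is allowed and gives the empty sum. The
  variable \<open>Y 0\<close> plays no role.\<close>

definition renewal_steps ::
    "'m measure \<Rightarrow> (nat \<Rightarrow> 'm \<Rightarrow> nat) \<Rightarrow> (nat \<Rightarrow> real) \<Rightarrow> bool" where
  "renewal_steps M Y u \<longleftrightarrow>
     prob_space M \<and>
     prob_space.indep_vars M (\<lambda>_. count_space UNIV) Y {1..} \<and>
     (\<forall>i\<ge>1. distr M (count_space UNIV) (Y i) = distr M (count_space UNIV) (Y 1)) \<and>
     (\<forall>i\<ge>1. \<forall>\<omega>\<in>space M. 0 < Y i \<omega>) \<and>
     (\<forall>k. measure M {\<omega> \<in> space M. \<exists>m. (\<Sum>i=1..m. Y i \<omega>) = k} = u k)"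

text \<open>The Riemann zeta function at integers \<open>n \<ge> 2\<close>.\<close>

definition zeta_nat :: "nat \<Rightarrow> real" where
  "zeta_nat n = (\<Sum>m. 1 / real (Suc m) ^ n)"

end

theory Submission
  imports Defs
begin

text \<open>
  The weights \<open>p n = 1 / q(n)\<close> are positive and sum to \<open>1\<close>, so \<open>u k\<close> is the \<open>k\<close>-th moment of
  the probability measure on \<open>[0, 1]\<close> that puts mass \<open>p n\<close> at \<open>1 / n\<close>. Everything rests on this.

  Existence of the renewal structure. The renewal equation with \<open>u 0 = 1\<close> always has a solution \<open>f\<close>,
  namely the coefficients of \<open>1 - 1 / U\<close>. Moment sequences are log-convex (Cauchy--Schwarz), and
  for a log-convex \<open>u\<close> all \<open>f k\<close> are nonnegative (Kaluza's theorem).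

  Moments of the step law. The tails \<open>T k = 1 - f 1 - \<dots> - f k\<close> satisfy
  \<open>(\<Sum>j\<le>k. T j * u (k - j)) = 1\<close>. The moments decrease to \<open>L = 1 / q(1)\<close>, the mass at the point \<open>1\<close>,
  and the excess \<open>D = (\<Sum>k. u k - L)\<close> is finite. Comparing \<open>u\<close> with the constant \<open>L\<close> in the identity
  for the tails gives \<open>\<Sum>T = 1 / L\<close> and, after one more summation, \<open>\<Sum>k. k * T k = D / L\<^sup>2\<close>. So the
  law has total mass \<open>1\<close>, mean \<open>1 / L = q(1)\<close> and second moment \<open>1 / L + 2 * D / L\<^sup>2\<close>
  (lemma \<open>renewal_moments\<close>).

  The digamma values. Summing geometric series, \<open>D = (\<Sum>n\<ge>2. p n * n / (n - 1))\<close>. Write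
  \<open>q(1) / (m * q(m + 1))\<close> as \<open>1 / m\<close> minus half the logarithmic derivative of \<open>q\<close> at \<open>m + 1\<close> minus a
  constant multiple of \<open>1 / q(m + 1)\<close>. The first two terms together sum to digamma values at the roots,
  and the last one is known from the normalization \<open>\<Sum>1 / q = 1\<close>. This decomposition needs no case
  distinction between simple and double roots, which is why no trigamma value occurs. The same kind of
  partial fraction, for \<open>q(z) * n / (q(n) * (n - z))\<close>, evaluates \<open>q(z) * U z\<close>.

  Probability. For i.i.d. positive steps, the hitting probabilities satisfy the renewal equation whose
  weights are the law of one step. Hence every process that realizes \<open>u\<close> has a step law to which the
  analytic results apply, and conversely i.i.d. steps with law \<open>f\<close> realize \<open>u\<close>.
\<close>

section \<open>Double series\<close>

lemma double_series_swap:
  fixes a :: "nat \<Rightarrow> nat \<Rightarrow> 'a::banach"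
  assumes R: "\<And>n. (\<lambda>k. norm (a n k)) sums R n" and sR: "summable R"
  shows "(\<lambda>k. \<Sum>n. a n k) sums (\<Sum>n. \<Sum>k. a n k)"
proof -
  have nonneg: "R n \<ge> 0" for n
    using R[of n] by (metis norm_ge_zero sums_unique suminf_nonneg sums_summable)
  have inner: "(\<lambda>k. norm (a n k)) summable_on UNIV" for n
    using R[of n] by (intro norm_summable_imp_summable_on) (simp add: sums_summable)
  have Req: "infsum (\<lambda>k. norm (a n k)) UNIV = R n" for n
    using R[of n] by (intro infsumI sums_nonneg_imp_has_sum) auto
  have abs: "(\<lambda>x. norm (case x of (n, k) \<Rightarrow> a n k)) summable_on UNIV \<times> UNIV"
    using inner nonneg sR
    by (intro Infinite_Sum.abs_summable_on_Sigma_iff[THEN iffD2])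
       (auto simp: Req intro!: norm_summable_imp_summable_on)
  then have abs': "(\<lambda>x. norm (case x of (k, n) \<Rightarrow> a n k)) summable_on UNIV \<times> UNIV"
    by (subst summable_on_swap) (simp add: case_prod_unfold)
  have sumUU: "(\<lambda>(n,k). a n k) summable_on UNIV \<times> UNIV"
    using abs by (rule abs_summable_summable)
  have sumUU': "(\<lambda>(k,n). a n k) summable_on UNIV \<times> UNIV"
    using abs' by (rule abs_summable_summable)
  have inner': "(\<lambda>n. norm (a n k)) summable_on UNIV" for k
    using abs' unfolding Infinite_Sum.abs_summable_on_Sigma_iff by auto
  have norm': "summable (\<lambda>n. norm (a n k))" for k
    using inner'[of k] by (rule summable_on_UNIV_nonneg_real_iff[THEN iffD1, rotated]) auto
  have e1: "(\<Sum>n. a n k) = infsum (\<lambda>n. a n k) UNIV" for k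
    using norm'[of k]
    by (metis infsumI norm_summable_imp_has_sum summable_norm_cancel summable_sums)
  have e2: "(\<Sum>k. a n k) = infsum (\<lambda>k. a n k) UNIV" for n
    using sums_summable[OF R[of n]]
    by (metis infsumI norm_summable_imp_has_sum summable_norm_cancel summable_sums)
  have out1: "(\<lambda>k. infsum (\<lambda>n. a n k) UNIV) summable_on UNIV"
    using sumUU' by (rule summable_on_Sigma_banach)
  have "(\<lambda>n. infsum (\<lambda>k. a n k) UNIV) summable_on UNIV"
    using sumUU by (rule summable_on_Sigma_banach)
  then have "(\<Sum>n. \<Sum>k. a n k) = infsum (\<lambda>n. infsum (\<lambda>k. a n k) UNIV) UNIV"
    unfolding e2 by (metis has_sum_infsum has_sum_imp_sums sums_unique)
  also have "\<dots> = infsum (\<lambda>k. infsum (\<lambda>n. a n k) UNIV) UNIV"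
    using sumUU by (rule infsum_swap_banach)
  finally show "(\<lambda>k. \<Sum>n. a n k) sums (\<Sum>n. \<Sum>k. a n k)"
    unfolding e1 using has_sum_infsum[OF out1] by (simp add: has_sum_imp_sums)
qed

text \<open>Partial summation: both sides evaluate the double series of \<open>w j * f k\<close> over \<open>j < k\<close>. With
  \<open>w = 1\<close> it turns a sum of tails into a first moment, with linear \<open>w\<close> into a second moment.\<close>

lemma weighted_tail_sums:
  fixes f w :: "nat \<Rightarrow> real"
  assumes f: "\<And>k. f k \<ge> 0" "f sums s" and w: "\<And>j. w j \<ge> 0"
    and S: "(\<lambda>j. w j * (s - (\<Sum>i\<le>j. f i))) sums S"
  shows "(\<lambda>k. (\<Sum>j<k. w j) * f k) sums S"
proof -
  define a where "a = (\<lambda>j k. if j < k then w j * f k else 0)"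
  have rows: "a j sums (w j * (s - (\<Sum>i\<le>j. f i)))" for j
  proof -
    have "(\<lambda>k. w j * (f k - (if k \<in> {..j} then f k else 0))) sums (w j * (s - (\<Sum>i\<le>j. f i)))"
      by (intro sums_mult sums_diff f sums_If_finite_set) auto
    also have "(\<lambda>k. w j * (f k - (if k \<in> {..j} then f k else 0))) = a j"
      by (auto simp: a_def fun_eq_iff)
    finally show ?thesis .
  qed
  have cols: "(\<lambda>j. a j k) sums ((\<Sum>j<k. w j) * f k)" for k
  proof -
    have "(\<lambda>j. if j \<in> {..<k} then w j * f k else 0) sums (\<Sum>j<k. w j * f k)"
      by (rule sums_If_finite_set) auto
    then show ?thesis by (simp add: a_def sum_distrib_right)
  qed
  have "(\<lambda>k. \<Sum>j. a j k) sums (\<Sum>j. \<Sum>k. a j k)"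
  proof (rule double_series_swap)
    show "(\<lambda>k. norm (a j k)) sums (w j * (s - (\<Sum>i\<le>j. f i)))" for j
      using rows[of j] f(1) w by (simp add: a_def if_distrib cong: if_cong)
  qed (use S in \<open>rule sums_summable\<close>)
  then show ?thesis
    using cols rows S by (simp add: sums_iff)
qed

section \<open>Renewal sequences\<close>

lemma renewal_equation_solvable:
  fixes u :: "nat \<Rightarrow> real"
  assumes "u 0 = 1"
  obtains f where "\<And>k. k \<ge> 1 \<Longrightarrow> u k = (\<Sum>j=1..k. f j * u (k - j))"
proof -
  define V where "V = inverse (Abs_fps u)"
  define f where "f = (\<lambda>k. - fps_nth V k)"
  have V: "V * Abs_fps u = 1" unfolding V_def by (rule inverse_mult_eq_1) (simp add: assms)
  have V0: "fps_nth V 0 = 1" by (simp add: V_def assms)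
  have "u k = (\<Sum>j=1..k. f j * u (k - j))" if "k \<ge> 1" for k
  proof -
    have "0 = fps_nth (V * Abs_fps u) k" using that by (simp add: V)
    also have "\<dots> = (\<Sum>j=0..k. fps_nth V j * u (k - j))" by (simp add: fps_mult_nth)
    also have "\<dots> = u k + (\<Sum>j=1..k. fps_nth V j * u (k - j))"
      by (subst sum.atLeast_Suc_atMost) (simp_all add: V0)
    finally show ?thesis by (simp add: f_def sum_negf)
  qed
  then show ?thesis by (rule that)
qed

text \<open>Kaluza's theorem. By log-convexity the ratios \<open>\<rho> k = u (k + 1) / u k\<close> increase. Multiplying the
  renewal equation for \<open>u n\<close> by \<open>\<rho> n\<close> and subtracting the one for \<open>u (n + 1)\<close> exhibits \<open>f (n + 1)\<close>
  as a sum of the terms \<open>f j * u (n - j) * (\<rho> n - \<rho> (n - j))\<close>, nonnegative by induction.\<close>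

lemma renewal_weights_nonneg_if_logconvex:
  fixes u f :: "nat \<Rightarrow> real"
  assumes u0: "u 0 = 1" and pos: "\<And>k. u k > 0"
    and logconvex: "\<And>k. (u (Suc k))\<^sup>2 \<le> u k * u (Suc (Suc k))"
    and rec: "\<And>k. k \<ge> 1 \<Longrightarrow> u k = (\<Sum>j=1..k. f j * u (k - j))"
    and k: "k \<ge> 1"
  shows "f k \<ge> 0"
  using k
proof (induction k rule: less_induct)
  case (less k)
  define \<rho> where "\<rho> = (\<lambda>k. u (Suc k) / u k)"
  have "\<rho> k \<le> \<rho> (Suc k)" for k
    using logconvex[of k] pos[of k] pos[of "Suc k"] by (simp add: \<rho>_def field_simps power2_eq_square)
  then have \<rho>: "\<rho> i \<le> \<rho> j" if "i \<le> j" for i j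
    using that by (rule lift_Suc_mono_le)
  show ?case
  proof (cases "k = 1")
    case True
    then show ?thesis using rec[of 1] pos[of 1] u0 by simp
  next
    case False
    then obtain n where n: "k = Suc n" "n \<ge> 1" using less.prems by (cases k) auto
    have "u (Suc n) = f (Suc n) + (\<Sum>j=1..n. f j * u (Suc n - j))"
      using rec[of "Suc n"] by (simp add: u0)
    moreover have "u (Suc n) = (\<Sum>j=1..n. f j * u (n - j) * \<rho> n)"
    proof -
      have "u (Suc n) = u n * \<rho> n" using pos[of n] by (simp add: \<rho>_def)
      then show ?thesis by (subst (asm) rec[OF n(2)]) (simp add: sum_distrib_right)
    qed
    moreover have "(\<Sum>j=1..n. f j * u (Suc n - j)) \<le> (\<Sum>j=1..n. f j * u (n - j) * \<rho> n)"
    proof (rule sum_mono)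
      fix j assume j: "j \<in> {1..n}"
      then have "u (Suc n - j) = u (n - j) * \<rho> (n - j)"
        using pos[of "n - j"] by (simp add: \<rho>_def Suc_diff_le)
      also have "\<dots> \<le> u (n - j) * \<rho> n"
        using pos[of "n - j"] \<rho>[of "n - j" n] by (simp add: mult_left_mono)
      finally show "f j * u (Suc n - j) \<le> f j * u (n - j) * \<rho> n"
        using less.IH[of j] j n by (simp add: mult.assoc mult_left_mono)
    qed
    ultimately show ?thesis using n by simp
  qed
qed

text \<open>An elementary form of the renewal theorem with rate. The tails satisfy
  \<open>(\<Sum>j\<le>k. T j * u (k - j)) = 1\<close>; splitting off the limit \<open>L\<close> of \<open>u\<close> leaves
  \<open>1 - L * (\<Sum>j\<le>k. T j) = (\<Sum>j\<le>k. T j * (u (k - j) - L))\<close>. The right side is a Cauchy product of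
  summable nonnegative sequences: it tends to \<open>0\<close>, which gives \<open>\<Sum>T = 1 / L\<close>, and its sum over \<open>k\<close> is
  \<open>D / L\<close>. The left side is then \<open>L\<close> times a tail of \<open>\<Sum>T\<close>, so \<open>\<Sum>k. k * T k = D / L\<^sup>2\<close> by partial
  summation. Two further partial summations lead from \<open>T\<close> to \<open>f\<close>.\<close>

lemma renewal_moments:
  fixes u f :: "nat \<Rightarrow> real"
  assumes u0: "u 0 = 1"
    and rec: "\<And>k. k \<ge> 1 \<Longrightarrow> u k = (\<Sum>j=1..k. f j * u (k - j))"
    and f: "\<And>k. k \<ge> 1 \<Longrightarrow> f k \<ge> 0"
    and L: "L > 0" "\<And>k. L \<le> u k" and D: "(\<lambda>k. u k - L) sums D"
  shows "(\<lambda>k. f (Suc k)) sums 1"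
    and "(\<lambda>k. real (Suc k) * f (Suc k)) sums (1 / L)"
    and "(\<lambda>k. (real (Suc k))\<^sup>2 * f (Suc k)) sums (1 / L + 2 * D / L\<^sup>2)"
proof -
  define \<phi> where "\<phi> = (\<lambda>k. f (Suc k))"
  define T where "T = (\<lambda>k. 1 - (\<Sum>i<k. \<phi> i))"
  have \<phi>: "\<phi> k \<ge> 0" for k by (simp add: \<phi>_def f)
  have recS: "u (Suc k) = (\<Sum>i\<le>k. \<phi> i * u (k - i))" for k
  proof -
    have "u (Suc k) = (\<Sum>j=Suc 0..Suc k. f j * u (Suc k - j))" using rec[of "Suc k"] by simp
    also have "\<dots> = (\<Sum>i=0..k. f (Suc i) * u (k - i))" by (subst sum.shift_bounds_cl_Suc_ivl) simp
    finally show ?thesis by (simp add: \<phi>_def atMost_atLeast0)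
  qed
  have conv: "(\<Sum>j\<le>k. T j * u (k - j)) = 1" for k
  proof (induction k)
    case 0
    then show ?case by (simp add: T_def u0)
  next
    case (Suc k)
    have "(\<Sum>j\<le>Suc k. T j * u (Suc k - j)) = u (Suc k) + (\<Sum>j\<le>k. T (Suc j) * u (k - j))"
      by (subst sum.atMost_Suc_shift) (simp add: T_def)
    also have "(\<Sum>j\<le>k. T (Suc j) * u (k - j)) = (\<Sum>j\<le>k. T j * u (k - j) - \<phi> j * u (k - j))"
      by (simp add: T_def algebra_simps)
    also have "\<dots> = 1 - u (Suc k)" by (simp add: sum_subtractf Suc recS)
    finally show ?case by simp
  qed
  have ulim: "u \<longlonglongrightarrow> L"
    using summable_LIMSEQ_zero[OF sums_summable[OF D]] by (simp add: LIM_zero_iff)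
  have T: "T k \<ge> 0" for k
  proof -
    \<comment> \<open>For \<open>n > k\<close> the renewal equation and \<open>u \<ge> L\<close> bound \<open>L * (\<Sum>i<k. \<phi> i)\<close> by \<open>u n\<close>, which tends to \<open>L\<close>.\<close>
    have "L * (\<Sum>i<k. \<phi> i) \<le> L"
    proof (rule tendsto_lowerbound[OF ulim])
      show "\<forall>\<^sub>F n in sequentially. L * (\<Sum>i<k. \<phi> i) \<le> u n"
        using eventually_ge_at_top[of "Suc k"]
      proof eventually_elim
        case (elim n)
        then obtain m where m: "n = Suc m" "k \<le> m" by (cases n) auto
        have "L * (\<Sum>i<k. \<phi> i) = (\<Sum>i<k. \<phi> i * L)" by (simp add: sum_distrib_left mult.commute)
        also have "\<dots> \<le> (\<Sum>i<k. \<phi> i * u (m - i))" by (intro sum_mono mult_left_mono L \<phi>)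
        also have "\<dots> \<le> (\<Sum>i\<le>m. \<phi> i * u (m - i))"
          using m \<phi> L by (intro sum_mono2) (auto intro!: mult_nonneg_nonneg intro: order_trans[of 0 L] less_imp_le)
        finally show ?case by (simp add: m recS)
      qed
    qed simp
    then show ?thesis using L by (simp add: T_def)
  qed
  have defect: "1 - L * (\<Sum>j\<le>k. T j) = (\<Sum>j\<le>k. T j * (u (k - j) - L))" for k
    using conv[of k] by (simp add: algebra_simps sum_subtractf sum_distrib_left)
  have "summable T"
  proof (rule bounded_imp_summable[OF T])
    fix k
    have "0 \<le> (\<Sum>j\<le>k. T j * (u (k - j) - L))" using T L by (intro sum_nonneg) simp
    then show "(\<Sum>j\<le>k. T j) \<le> 1 / L" using L defect[of k] by (simp add: field_simps)
  qed
  have cauchy: "(\<lambda>k. 1 - L * (\<Sum>j\<le>k. T j)) sums ((\<Sum>k. T k) * D)"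
    unfolding defect sums_unique[OF D]
    using \<open>summable T\<close> T L D by (intro Cauchy_product_sums) (auto simp: sums_iff)
  then have "(\<lambda>k. 1 - L * (\<Sum>j\<le>k. T j)) \<longlonglongrightarrow> 0" by (auto simp: sums_iff dest: summable_LIMSEQ_zero)
  from tendsto_divide[OF tendsto_diff[OF tendsto_const[of 1] this] tendsto_const[of L]]
  have "(\<lambda>k. (\<Sum>j\<le>k. T j)) \<longlonglongrightarrow> 1 / L" using L by simp
  then have Tsum: "T sums (1 / L)" by (simp add: sums_def_le)
  have "T \<longlonglongrightarrow> 0" using \<open>summable T\<close> by (rule summable_LIMSEQ_zero)
  from tendsto_diff[OF tendsto_const[of 1] this]
  have \<phi>1: "\<phi> sums 1" by (simp add: sums_def T_def)
  then show "(\<lambda>k. f (Suc k)) sums 1" by (simp add: \<phi>_def)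
  \<comment> \<open>\<open>T (Suc j)\<close> is the tail of \<open>\<phi>\<close> beyond index \<open>j\<close>; the missing \<open>T 0 = 1\<close> accounts for the shift
    from \<open>k * \<phi> k\<close> to \<open>Suc k * \<phi> k\<close>.\<close>
  have TS: "(\<lambda>j. T (Suc j)) sums (1 / L - 1)"
    using Tsum by (subst sums_Suc_iff) (simp add: T_def)
  have "(\<lambda>k. (\<Sum>j<k. 1) * \<phi> k) sums (1 / L - 1)"
    by (rule weighted_tail_sums[OF \<phi> \<phi>1]) (use TS in \<open>simp_all add: T_def lessThan_Suc_atMost\<close>)
  from sums_add[OF this \<phi>1] have mean: "(\<lambda>k. real (Suc k) * \<phi> k) sums (1 / L)"
    by (simp add: algebra_simps)
  then show "(\<lambda>k. real (Suc k) * f (Suc k)) sums (1 / L)" by (simp add: \<phi>_def)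
  have "(\<lambda>k. 1 / L * (1 - L * (\<Sum>j\<le>k. T j))) sums (1 / L * ((\<Sum>k. T k) * D))"
    using cauchy by (rule sums_mult)
  also have "(\<lambda>k. 1 / L * (1 - L * (\<Sum>j\<le>k. T j))) = (\<lambda>k. 1 * (1 / L - (\<Sum>j\<le>k. T j)))"
    using L by (simp add: field_simps)
  also have "1 / L * ((\<Sum>k. T k) * D) = D / L\<^sup>2"
    by (simp add: sums_unique[OF Tsum, symmetric] power2_eq_square)
  finally have "(\<lambda>k. (\<Sum>j<k. 1) * T k) sums (D / L\<^sup>2)"
    by (intro weighted_tail_sums[OF T Tsum]) simp_all
  then have "(\<lambda>k. real (Suc k) * T (Suc k)) sums (D / L\<^sup>2)"
    by (subst sums_Suc_iff) simp
  then have "(\<lambda>k. (\<Sum>j<k. real (Suc j)) * \<phi> k) sums (D / L\<^sup>2)"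
    by (intro weighted_tail_sums[OF \<phi> \<phi>1]) (simp_all add: T_def lessThan_Suc_atMost)
  moreover have "(\<Sum>j<k. real (Suc j)) = real k * real (Suc k) / 2" for k
    by (induction k) (simp_all add: field_simps)
  ultimately have "(\<lambda>k. real k * real (Suc k) / 2 * \<phi> k) sums (D / L\<^sup>2)" by (simp only:)
  from sums_add[OF mean sums_mult[OF this, of 2]]
  have "(\<lambda>k. real (Suc k) * \<phi> k + 2 * (real k * real (Suc k) / 2 * \<phi> k)) sums (1 / L + 2 * D / L\<^sup>2)"
    by simp
  also have "(\<lambda>k. real (Suc k) * \<phi> k + 2 * (real k * real (Suc k) / 2 * \<phi> k)) = (\<lambda>k. (real (Suc k))\<^sup>2 * \<phi> k)"
    by (simp add: fun_eq_iff power2_eq_square algebra_simps)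
  finally show "(\<lambda>k. (real (Suc k))\<^sup>2 * f (Suc k)) sums (1 / L + 2 * D / L\<^sup>2)" by (simp add: \<phi>_def)
qed

lemma renewal_generating_function:
  fixes u f :: "nat \<Rightarrow> real" and z :: complex
  assumes u0: "u 0 = 1" and rec: "\<And>k. k \<ge> 1 \<Longrightarrow> u k = (\<Sum>j=1..k. f j * u (k - j))"
    and f0: "f 0 = 0"
    and sf: "summable (\<lambda>k. norm (of_real (f k) * z ^ k))"
    and su: "summable (\<lambda>k. norm (of_real (u k) * z ^ k))"
  defines "W \<equiv> \<Sum>k. of_real (u k) * z ^ k"
  shows "W \<noteq> 0" and "(\<Sum>k. of_real (f k) * z ^ k) = 1 - 1 / W"
proof -
  define F where "F = (\<Sum>k. of_real (f k) * z ^ k)"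
  have "(\<lambda>k. \<Sum>j\<le>k. (of_real (f j) * z ^ j) * (of_real (u (k - j)) * z ^ (k - j))) sums (F * W)"
    unfolding F_def W_def using sf su by (rule Cauchy_product_sums)
  also have "(\<lambda>k. \<Sum>j\<le>k. (of_real (f j) * z ^ j) * (of_real (u (k - j)) * z ^ (k - j)))
     = (\<lambda>k. if k = 0 then 0 else of_real (u k) * z ^ k)"
  proof
    fix k
    have "(\<Sum>j\<le>k. (of_real (f j) * z ^ j) * (of_real (u (k - j)) * z ^ (k - j)))
       = (\<Sum>j\<le>k. of_real (f j * u (k - j)) * z ^ k)"
      by (intro sum.cong) (auto simp: mult_ac simp flip: power_add)
    also have "\<dots> = of_real (\<Sum>j\<le>k. f j * u (k - j)) * z ^ k" by (simp add: sum_distrib_right)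
    also have "(\<Sum>j\<le>k. f j * u (k - j)) = (\<Sum>j=1..k. f j * u (k - j))"
      by (rule sum.mono_neutral_right) (auto simp: f0 not_less_eq_eq)
    also have "\<dots> = (if k = 0 then 0 else u k)" using rec[of k] by simp
    finally show "(\<Sum>j\<le>k. (of_real (f j) * z ^ j) * (of_real (u (k - j)) * z ^ (k - j)))
      = (if k = 0 then 0 else of_real (u k) * z ^ k)" by simp
  qed
  finally have "(\<lambda>k. if k = 0 then 0 else of_real (u k) * z ^ k) sums (F * W)" .
  moreover have "(\<lambda>k. if k = 0 then 1 else 0) sums (1::complex)"
    using sums_single[of 0 "\<lambda>_. 1"] by (simp add: eq_commute)
  ultimately have "(\<lambda>k. (if k = 0 then 0 else of_real (u k) * z ^ k) + (if k = 0 then 1 else 0)) sums (F * W + 1)"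
    by (rule sums_add)
  also have "(\<lambda>k. (if k = 0 then 0 else of_real (u k) * z ^ k) + (if k = 0 then 1 else 0)) =
      (\<lambda>k. of_real (u k) * z ^ k)"
    by (auto simp: fun_eq_iff u0)
  finally have "W = F * W + 1" unfolding W_def by (rule sums_unique[symmetric])
  then have eq: "(1 - F) * W = 1" by (simp add: algebra_simps)
  then show "W \<noteq> 0" by auto
  with eq have "1 - F = 1 / W" by (simp add: field_simps)
  then show "(\<Sum>k. of_real (f k) * z ^ k) = 1 - 1 / W" unfolding F_def by (simp add: algebra_simps)
qed

section \<open>Hitting probabilities of random walks with positive steps\<close>

context prob_space
begin

lemma distr_eq_density_nat:
  fixes X :: "'a \<Rightarrow> nat"
  assumes X: "X \<in> measurable M (count_space UNIV)"
  shows "distr M (count_space UNIV) X = density (count_space UNIV) (\<lambda>k. ennreal (prob {\<omega> \<in> space M. X \<omega> = k}))"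
proof (rule measure_eqI_countable[where A = UNIV])
  fix k
  have "emeasure (distr M (count_space UNIV) X) {k} = emeasure M {\<omega> \<in> space M. X \<omega> = k}"
    using X by (subst emeasure_distr) (auto intro!: arg_cong[where f = "emeasure M"])
  also have "\<dots> = ennreal (prob {\<omega> \<in> space M. X \<omega> = k})" by (rule emeasure_eq_measure)
  also have "\<dots> = emeasure (density (count_space UNIV) (\<lambda>k. ennreal (prob {\<omega> \<in> space M. X \<omega> = k}))) {k}"
    by (subst emeasure_density) (auto simp: nn_integral_count_space_indicator[symmetric])
  finally show "emeasure (distr M (count_space UNIV) X) {k} =
    emeasure (density (count_space UNIV) (\<lambda>k. ennreal (prob {\<omega> \<in> space M. X \<omega> = k}))) {k}" .
qed auto

lemma expectation_nat_valued:
  fixes X :: "'a \<Rightarrow> nat" and h :: "nat \<Rightarrow> 'b::{banach, second_countable_topology}"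
  assumes X: "X \<in> measurable M (count_space UNIV)"
    and sum: "summable (\<lambda>k. prob {\<omega> \<in> space M. X \<omega> = k} * norm (h k))"
  shows "integrable M (\<lambda>\<omega>. h (X \<omega>))"
    and "expectation (\<lambda>\<omega>. h (X \<omega>)) = (\<Sum>k. prob {\<omega> \<in> space M. X \<omega> = k} *\<^sub>R h k)"
proof -
  let ?g = "\<lambda>k. prob {\<omega> \<in> space M. X \<omega> = k}"
  have int: "integrable (count_space UNIV) (\<lambda>k. ?g k *\<^sub>R h k)"
    using sum by (simp add: integrable_count_space_nat_iff)
  then have "integrable (distr M (count_space UNIV) X) h"
    unfolding distr_eq_density_nat[OF X] by (subst integrable_density) auto
  then show "integrable M (\<lambda>\<omega>. h (X \<omega>))"
    using X by (simp add: integrable_distr_eq)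
  have "expectation (\<lambda>\<omega>. h (X \<omega>)) = integral\<^sup>L (distr M (count_space UNIV) X) h"
    using X by (simp add: integral_distr)
  also have "\<dots> = integral\<^sup>L (count_space UNIV) (\<lambda>k. ?g k *\<^sub>R h k)"
    unfolding distr_eq_density_nat[OF X] by (subst integral_density) auto
  also have "\<dots> = (\<Sum>k. ?g k *\<^sub>R h k)" using int by (rule integral_count_space_nat)
  finally show "expectation (\<lambda>\<omega>. h (X \<omega>)) = (\<Sum>k. ?g k *\<^sub>R h k)" .
qed

lemma prob_nat_valued_sums:
  fixes X :: "'a \<Rightarrow> nat"
  assumes X: "X \<in> measurable M (count_space UNIV)"
  shows "(\<lambda>k. prob {\<omega> \<in> space M. X \<omega> = k}) sums 1"
proof -
  have "(\<lambda>k. prob {\<omega> \<in> space M. X \<omega> = k}) sums prob (\<Union>k. {\<omega> \<in> space M. X \<omega> = k})"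
    using X by (intro finite_measure_UNION) (auto simp: disjoint_family_on_def)
  also have "(\<Union>k. {\<omega> \<in> space M. X \<omega> = k}) = space M" by auto
  finally show ?thesis by (simp add: prob_space)
qed

text \<open>Conditioning on the last step instead of the first avoids any shift of the process. The law of
  the partial sum \<open>S (m + 1)\<close> is the convolution of the step law with that of \<open>S m\<close>. As the partial
  sums increase strictly, \<open>v k\<close> is the sum over \<open>m\<close> of the probabilities of \<open>S m = k\<close>, and only
  \<open>m \<le> k\<close> contributes. Summing the convolution identity over \<open>m\<close> gives the renewal equation.\<close>

lemma renewal_equation_hitting:
  fixes Y :: "nat \<Rightarrow> 'a \<Rightarrow> nat"
  assumes indep: "indep_vars (\<lambda>_. count_space UNIV) Y {1..}"
    and ident: "\<And>i. i \<ge> 1 \<Longrightarrow> distr M (count_space UNIV) (Y i) = distr M (count_space UNIV) (Y 1)"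
    and pos: "\<And>i \<omega>. i \<ge> 1 \<Longrightarrow> \<omega> \<in> space M \<Longrightarrow> 0 < Y i \<omega>"
  defines "g \<equiv> \<lambda>k. prob {\<omega> \<in> space M. Y 1 \<omega> = k}"
    and "v \<equiv> \<lambda>k. prob {\<omega> \<in> space M. \<exists>m. (\<Sum>i=1..m. Y i \<omega>) = k}"
  shows "v 0 = 1" and "k \<ge> 1 \<Longrightarrow> v k = (\<Sum>j=1..k. g j * v (k - j))"
proof -
  define S where "S = (\<lambda>m \<omega>. \<Sum>i=1..m. Y i \<omega>)"
  have S_eq: "S m \<omega> = (\<Sum>i=1..m. Y i \<omega>)" for m \<omega> by (simp add: S_def)
  define h where "h = (\<lambda>m k. prob {\<omega> \<in> space M. S m \<omega> = k})"
  have Y: "Y i \<in> measurable M (count_space UNIV)" if "i \<ge> 1" for i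
    using indep that by (auto simp: indep_vars_def)
  have S: "S m \<in> measurable M (count_space UNIV)" for m
    unfolding S_def by (intro measurable_sum_nat Y) auto
  have Sge: "m \<le> S m \<omega>" if "\<omega> \<in> space M" for m \<omega>
  proof (induction m)
    case (Suc m)
    then show ?case using pos[of "Suc m", OF _ that] by (simp add: S_def)
  qed simp
  have Sinj: "m = n" if "S m \<omega> = S n \<omega>" "\<omega> \<in> space M" for m n \<omega>
  proof -
    have "strict_mono (\<lambda>m. S m \<omega>)" using pos that by (intro strict_monoI_Suc) (simp add: S_def)
    then show ?thesis using that by (auto dest: strict_mono_eq)
  qed
  have law: "prob {\<omega> \<in> space M. Y i \<omega> = j} = g j" if "i \<ge> 1" for i j
  proof -
    have "measure (distr M (count_space UNIV) (Y i)) {j} = measure (distr M (count_space UNIV) (Y 1)) {j}"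
      using ident[OF that] by simp
    then show ?thesis using Y[OF that] Y[of 1]
      by (simp add: measure_distr g_def vimage_def Int_def conj_commute)
  qed
  have h0: "h 0 k = (if k = 0 then 1 else 0)" for k
    by (auto simp: h_def S_def prob_space)
  have hSuc: "h (Suc m) k = (\<Sum>j=1..k. g j * h m (k - j))" for m k
  proof -
    have "indep_vars (\<lambda>_. borel) (\<lambda>i \<omega>. real (Y i \<omega>)) {1..}"
      using indep by (rule indep_vars_compose2) auto
    then have "indep_vars (\<lambda>_. borel) (\<lambda>i \<omega>. real (Y i \<omega>)) (insert (Suc m) {1..m})"
      by (rule indep_vars_subset) auto
    then have "indep_var borel (\<lambda>\<omega>. real (Y (Suc m) \<omega>)) borel (\<lambda>\<omega>. \<Sum>i=1..m. real (Y i \<omega>))"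
      by (intro indep_vars_sum) auto
    then have ind: "indep_var borel (\<lambda>\<omega>. real (Y (Suc m) \<omega>)) borel (\<lambda>\<omega>. real (S m \<omega>))"
      by (simp add: S_def)
    have prod: "prob {\<omega> \<in> space M. Y (Suc m) \<omega> = j \<and> S m \<omega> = l} = g j * h m l" for j l
    proof -
      from indep_varD[OF ind, of "{real j}" "{real l}"]
      have "prob {\<omega> \<in> space M. Y (Suc m) \<omega> = j \<and> S m \<omega> = l} =
        prob {\<omega> \<in> space M. Y (Suc m) \<omega> = j} * prob {\<omega> \<in> space M. S m \<omega> = l}"
        by (simp add: vimage_def Int_def conj_ac)
      then show ?thesis by (simp add: law h_def)
    qed
    have "h (Suc m) k = prob (\<Union>j\<in>{1..k}. {\<omega> \<in> space M. Y (Suc m) \<omega> = j \<and> S m \<omega> = k - j})"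
      unfolding h_def using pos[of "Suc m"]
      by (intro arg_cong[where f = prob]) (auto simp: S_def Suc_le_eq)
    also have "\<dots> = (\<Sum>j=1..k. prob {\<omega> \<in> space M. Y (Suc m) \<omega> = j \<and> S m \<omega> = k - j})"
    proof (intro finite_measure_finite_Union)
      have [measurable]: "Y (Suc m) \<in> measurable M (count_space UNIV)" "S m \<in> measurable M (count_space UNIV)"
        using Y[of "Suc m"] S by auto
      show "(\<lambda>j. {\<omega> \<in> space M. Y (Suc m) \<omega> = j \<and> S m \<omega> = k - j}) ` {1..k} \<subseteq> events"
        by auto
    qed (auto simp: disjoint_family_on_def)
    finally show ?thesis by (simp add: prod)
  qed
  have hz: "h m k = 0" if "k < m" for m k
  proof -
    have "S m \<omega> \<noteq> k" if "\<omega> \<in> space M" for \<omega>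
      using Sge[OF that, of m] \<open>k < m\<close> by simp
    then have "{\<omega> \<in> space M. S m \<omega> = k} = {}" by auto
    then show ?thesis by (simp only: h_def measure_empty)
  qed
  have v: "v k = (\<Sum>m\<le>n. h m k)" if "k \<le> n" for k n
  proof -
    have le: "m \<le> n" if "\<omega> \<in> space M" "S m \<omega> = k" for m \<omega>
      using Sge[OF that(1), of m] that \<open>k \<le> n\<close> by simp
    have "v k = prob (\<Union>m\<in>{..n}. {\<omega> \<in> space M. S m \<omega> = k})"
      unfolding v_def S_eq[symmetric] using le by (intro arg_cong[where f = prob]) auto
    also have "\<dots> = (\<Sum>m\<le>n. h m k)" unfolding h_def
      using S Sinj by (intro finite_measure_finite_Union) (auto simp: disjoint_family_on_def)
    finally show ?thesis .
  qed
  show "v 0 = 1" using v[of 0 0] by (simp add: h0)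
  show "v k = (\<Sum>j=1..k. g j * v (k - j))" if k: "k \<ge> 1"
  proof -
    obtain n where n: "k = Suc n" using k by (cases k) auto
    have "v k = (\<Sum>m\<le>n. h (Suc m) k)"
      using v[of k "Suc n"] n by (simp add: sum.atMost_Suc_shift h0 del: sum.atMost_Suc)
    also have "\<dots> = (\<Sum>j=1..k. g j * (\<Sum>m\<le>n. h m (k - j)))"
      unfolding hSuc by (subst sum.swap) (simp add: sum_distrib_left)
    also have "\<dots> = (\<Sum>j=1..k. g j * v (k - j))"
      using n by (intro sum.cong refl) (subst v[of _ n], auto)
    finally show ?thesis .
  qed
qed

end

text \<open>Coordinates of an infinite product of the law \<open>k \<mapsto> f (k + 1)\<close> on \<open>{0, 1, \<dots>}\<close>, each
  increased by one: so every step is positive at every sample point, not only almost surely.\<close>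

lemma renewal_steps_exist:
  fixes f u :: "nat \<Rightarrow> real"
  assumes f: "\<And>k. k \<ge> 1 \<Longrightarrow> f k \<ge> 0" "(\<lambda>k. f (Suc k)) sums 1"
    and u0: "u 0 = 1" and rec: "\<And>k. k \<ge> 1 \<Longrightarrow> u k = (\<Sum>j=1..k. f j * u (k - j))"
  shows "\<exists>(M :: (nat \<Rightarrow> nat) measure) Y. renewal_steps M Y u"
proof -
  define p where "p = embed_pmf (\<lambda>k. f (Suc k))"
  have p: "pmf p k = f (Suc k)" for k
    unfolding p_def
  proof (rule pmf_embed_pmf)
    have "(\<Sum>k. ennreal (f (Suc k))) = ennreal (\<Sum>k. f (Suc k))"
      using f by (intro suminf_ennreal2) (auto simp: sums_iff)
    then show "(\<integral>\<^sup>+ k. ennreal (f (Suc k)) \<partial>count_space UNIV) = 1"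
      using f(2) by (simp add: nn_integral_count_space_nat sums_iff)
  qed (use f in auto)
  define M where "M = (\<Pi>\<^sub>M i\<in>(UNIV::nat set). measure_pmf p)"
  define Y where "Y = (\<lambda>(i::nat) (\<omega>::nat \<Rightarrow> nat). Suc (\<omega> i))"
  interpret prod: product_prob_space "\<lambda>_. measure_pmf p" "UNIV :: nat set" ..
  interpret prob_space M unfolding M_def by (rule prod.prob_space_axioms)
  have coord: "(\<lambda>\<omega>. \<omega> i) \<in> measurable M (measure_pmf p)" for i
    unfolding M_def by (rule measurable_component_singleton) simp
  have dist: "distr M (measure_pmf p) (\<lambda>\<omega>. \<omega> i) = measure_pmf p" for i
    unfolding M_def by (rule prod.PiM_component) simp
  have "indep_vars (\<lambda>_. measure_pmf p) (\<lambda>i \<omega>. \<omega> i) (UNIV :: nat set)"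
  proof (subst indep_vars_iff_distr_eq_PiM')
    show "distr M (\<Pi>\<^sub>M i\<in>UNIV. measure_pmf p) (\<lambda>x. \<lambda>i\<in>UNIV. x i) =
      (\<Pi>\<^sub>M i\<in>UNIV. distr M (measure_pmf p) (\<lambda>\<omega>. \<omega> i))"
      unfolding dist by (simp add: M_def restrict_def distr_id2)
  qed (use coord in auto)
  then have ind: "indep_vars (\<lambda>_. count_space UNIV) Y UNIV"
    unfolding Y_def by (rule indep_vars_compose2) auto
  then have ind': "indep_vars (\<lambda>_. count_space UNIV) Y {1..}"
    by (rule indep_vars_subset) auto
  have dY: "distr M (count_space UNIV) (Y i) = distr (measure_pmf p) (count_space UNIV) Suc" for i
  proof -
    have "distr (measure_pmf p) (count_space UNIV) Suc =
      distr (distr M (measure_pmf p) (\<lambda>\<omega>. \<omega> i)) (count_space UNIV) Suc"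
      by (simp add: dist)
    also have "\<dots> = distr M (count_space UNIV) (Suc \<circ> (\<lambda>\<omega>. \<omega> i))"
      using coord by (intro distr_distr) auto
    finally show ?thesis by (simp add: Y_def comp_def)
  qed
  have same: "distr M (count_space UNIV) (Y i) = distr M (count_space UNIV) (Y 1)" for i
    by (simp only: dY)
  have pos: "0 < Y i \<omega>" for i \<omega> by (simp add: Y_def)
  define v where "v = (\<lambda>k. prob {\<omega> \<in> space M. \<exists>m. (\<Sum>i=1..m. Y i \<omega>) = k})"
  have g: "prob {\<omega> \<in> space M. Y 1 \<omega> = k} = f k" if "k \<ge> 1" for k
  proof -
    obtain l where l: "k = Suc l" using \<open>k \<ge> 1\<close> by (cases k) auto
    have "{\<omega> \<in> space M. Y 1 \<omega> = k} = (\<lambda>\<omega>. \<omega> 1) -` {l} \<inter> space M" by (auto simp: Y_def l)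
    then have "prob {\<omega> \<in> space M. Y 1 \<omega> = k} = measure (distr M (measure_pmf p) (\<lambda>\<omega>. \<omega> 1)) {l}"
      using coord[of 1] by (simp add: measure_distr)
    then show ?thesis by (simp add: dist l p measure_pmf_single)
  qed
  have v0: "v 0 = 1" and vrec: "\<And>k. k \<ge> 1 \<Longrightarrow> v k = (\<Sum>j=1..k. f j * v (k - j))"
    using renewal_equation_hitting[OF ind' same pos] g by (simp_all add: v_def)
  have "v k = u k" for k
  proof (induction k rule: less_induct)
    case (less k)
    show ?case
    proof (cases "k = 0")
      case False
      then have "v k = (\<Sum>j=1..k. f j * v (k - j))" by (intro vrec) simp
      also have "\<dots> = (\<Sum>j=1..k. f j * u (k - j))" using less False by (intro sum.cong) auto
      also have "\<dots> = u k" using False by (intro rec[symmetric]) simp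
      finally show ?thesis .
    qed (simp add: v0 u0)
  qed
  then have "renewal_steps M Y u"
    unfolding renewal_steps_def using prob_space_axioms ind' same pos by (auto simp: v_def)
  then show ?thesis by blast
qed

text \<open>The law of the first step is a solution of the renewal equation for \<open>u\<close>, which brings all
  results on such solutions to bear on any process that realizes \<open>u\<close>.\<close>

lemma renewal_steps_law:
  fixes Y :: "nat \<Rightarrow> 'm \<Rightarrow> nat"
  assumes steps: "renewal_steps M Y u"
  defines "g \<equiv> \<lambda>k. measure M {\<omega> \<in> space M. Y 1 \<omega> = k}"
  shows "prob_space M" and "Y 1 \<in> measurable M (count_space UNIV)"
    and "g 0 = 0" and "renewal_law g u"
proof -
  from steps interpret prob_space M by (simp add: renewal_steps_def)
  have indep: "indep_vars (\<lambda>_. count_space UNIV) Y {1..}"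
    and ident: "\<And>i. i \<ge> 1 \<Longrightarrow> distr M (count_space UNIV) (Y i) = distr M (count_space UNIV) (Y 1)"
    and pos: "\<And>i \<omega>. i \<ge> 1 \<Longrightarrow> \<omega> \<in> space M \<Longrightarrow> 0 < Y i \<omega>"
    and hit: "\<And>k. prob {\<omega> \<in> space M. \<exists>m. (\<Sum>i=1..m. Y i \<omega>) = k} = u k"
    using steps unfolding renewal_steps_def by blast+
  show "prob_space M" by (rule prob_space_axioms)
  show Y1: "Y 1 \<in> measurable M (count_space UNIV)"
    using indep by (auto simp: indep_vars_def)
  have "{\<omega> \<in> space M. Y 1 \<omega> = 0} = {}" using pos[of 1] by force
  then show g0: "g 0 = 0" by (simp only: g_def measure_empty)
  have "g sums 1" unfolding g_def by (rule prob_nat_valued_sums[OF Y1])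
  then have "(\<lambda>k. g (Suc k)) sums 1" by (subst sums_Suc_iff) (simp add: g0)
  moreover have "u 0 = 1" "\<And>k. k \<ge> 1 \<Longrightarrow> u k = (\<Sum>j=1..k. g j * u (k - j))"
    using renewal_equation_hitting[OF indep ident pos] unfolding hit g_def by blast+
  ultimately show "renewal_law g u"
    unfolding renewal_law_def by (simp add: sums_iff) (simp add: g_def)
qed

section \<open>Digamma series\<close>

lemma Digamma_sums_shifted:
  fixes z :: complex
  assumes "z \<notin> {r. \<exists>n::nat. r = of_nat (Suc n)}"
  shows "(\<lambda>n. 1 / of_nat (Suc n) - 1 / (of_nat (Suc n) - z)) sums (Digamma (1 - z) + euler_mascheroni)"
proof -
  have "1 - z \<noteq> 0" using assms by (auto intro: exI[of _ 0])
  from summable_sums[OF summable_Digamma[OF this]]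
  show ?thesis by (simp add: Digamma_def inverse_eq_divide algebra_simps)
qed

lemma norm_divide_Suc_le:
  fixes z :: complex
  shows "norm (z / of_nat (Suc n)) \<le> norm z"
proof -
  have "norm (z / of_nat (Suc n)) = norm z / real (Suc n)" by (simp add: norm_divide del: of_nat_Suc)
  also have "\<dots> \<le> norm z / 1" by (intro divide_left_mono) auto
  finally show ?thesis by simp
qed

text \<open>Row \<open>m\<close> of the double series \<open>(z / m) ^ n\<close>, \<open>m \<ge> 1\<close>, \<open>n \<ge> 2\<close>, is a geometric series
  with sum \<open>- z * (1 / m - 1 / (m - z))\<close>, so the sum of the rows is a digamma series; the columns
  give zeta values.\<close>

lemma zeta_generating_function:
  fixes z :: complex
  assumes z: "norm z < 1"
  shows "(\<lambda>n. of_real (zeta_nat (n + 2)) * z ^ (n + 2)) sums (- z * (euler_mascheroni + Digamma (1 - z)))"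
proof -
  define a where "a = (\<lambda>m n. (z / of_nat (Suc m)) ^ (n + 2))"
  have nz: "of_nat (Suc m) - z \<noteq> 0" for m
  proof
    assume "of_nat (Suc m) - z = 0"
    then have "z = of_nat (Suc m)" by simp
    then have "norm z = real (Suc m)" by (metis norm_of_nat)
    then show False using z by simp
  qed
  have q: "norm (z / of_nat (Suc m)) < 1" for m
    using order_le_less_trans[OF norm_divide_Suc_le z] .
  define R where "R = (\<lambda>m. norm (z / of_nat (Suc m)) ^ 2 * (1 / (1 - norm (z / of_nat (Suc m)))))"
  have Rs: "(\<lambda>n. norm (a m n)) sums R m" for m
  proof -
    have "(\<lambda>n. norm (z / of_nat (Suc m)) ^ 2 * norm (z / of_nat (Suc m)) ^ n) sums R m"
      unfolding R_def using q[of m] by (intro sums_mult geometric_sums) simp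
    then show ?thesis by (simp only: a_def norm_mult norm_power power_add mult.commute)
  qed
  have sR: "summable R"
  proof (rule summable_comparison_test')
    show "summable (\<lambda>m. inverse (real (Suc m) ^ 2) * (1 / (1 - norm z)))"
      using inverse_power_summable[of 2, where 'a = real] by (intro summable_mult2) (subst summable_Suc_iff, simp)
    fix m :: nat
    have le: "norm (z / of_nat (Suc m)) \<le> norm z"
      by (rule norm_divide_Suc_le)
    have "norm (z / of_nat (Suc m)) ^ 2 \<le> inverse (real (Suc m) ^ 2)"
    proof -
      have "norm (z / of_nat (Suc m)) = norm z / real (Suc m)" by (simp add: norm_divide del: of_nat_Suc)
      also have "\<dots> \<le> 1 / real (Suc m)" using z by (intro divide_right_mono) auto
      finally show ?thesis
        using power_mono[of "norm (z / of_nat (Suc m))" "1 / real (Suc m)" 2]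
        by (simp add: power_divide inverse_eq_divide)
    qed
    moreover have "1 / (1 - norm (z / of_nat (Suc m))) \<le> 1 / (1 - norm z)"
      using z le by (intro divide_left_mono) (auto simp: intro!: mult_pos_pos order_le_less_trans[OF le])
    ultimately show "norm (R m) \<le> inverse (real (Suc m) ^ 2) * (1 / (1 - norm z))"
      using mult_mono[of "norm (z / of_nat (Suc m)) ^ 2" "inverse (real (Suc m) ^ 2)"
        "1 / (1 - norm (z / of_nat (Suc m)))" "1 / (1 - norm z)"] q[of m]
      unfolding R_def by (simp add: abs_mult del: of_nat_Suc times_divide_eq_right)
  qed
  have col: "(\<lambda>m. a m n) sums (of_real (zeta_nat (n + 2)) * z ^ (n + 2))" for n
  proof -
    have "summable (\<lambda>m. 1 / real (Suc m) ^ (n + 2))"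
      using inverse_power_summable[of "n + 2", where 'a = real]
      by (subst summable_Suc_iff) (simp add: inverse_eq_divide)
    then have "(\<lambda>m. 1 / real (Suc m) ^ (n + 2)) sums zeta_nat (n + 2)"
      unfolding zeta_nat_def by (rule summable_sums)
    then have "(\<lambda>m. of_real (1 / real (Suc m) ^ (n + 2)) * z ^ (n + 2)) sums
        (of_real (zeta_nat (n + 2)) * z ^ (n + 2))"
      by (intro sums_mult2 sums_of_real)
    then show ?thesis by (simp add: a_def power_divide)
  qed
  have row: "(\<Sum>n. a m n) = - z * (1 / of_nat (Suc m) - 1 / (of_nat (Suc m) - z))" for m
  proof -
    let ?w = "z / of_nat (Suc m)"
    have "(\<lambda>n. ?w ^ 2 * ?w ^ n) sums (?w ^ 2 * (1 / (1 - ?w)))"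
      using q[of m] by (intro sums_mult geometric_sums)
    then have "(\<Sum>n. a m n) = ?w ^ 2 * (1 / (1 - ?w))"
      by (simp only: a_def sums_iff power_add mult.commute)
    also have "\<dots> = - z * (1 / of_nat (Suc m) - 1 / (of_nat (Suc m) - z))"
      using nz[of m] by (simp add: divide_simps power2_eq_square del: of_nat_Suc)
    finally show ?thesis .
  qed
  have "(\<lambda>m. - z * (1 / of_nat (Suc m) - 1 / (of_nat (Suc m) - z))) sums (- z * (Digamma (1 - z) + euler_mascheroni))"
    using nz by (intro sums_mult Digamma_sums_shifted) auto
  then have "(\<Sum>m. \<Sum>n. a m n) = - z * (euler_mascheroni + Digamma (1 - z))"
    by (simp add: row sums_iff add.commute)
  moreover have "(\<lambda>n. \<Sum>m. a m n) sums (\<Sum>m. \<Sum>n. a m n)"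
    using Rs sR by (rule double_series_swap)
  ultimately show ?thesis using col by (simp add: sums_iff)
qed

section \<open>Moments of a probability on the reciprocals of the positive integers\<close>

text \<open>The index is shifted: \<open>p n\<close> is the mass at \<open>1 / (n + 1)\<close>, so \<open>p 0\<close> sits at the point \<open>1\<close>.\<close>

locale harmonic_moments =
  fixes p :: "nat \<Rightarrow> real" and u :: "nat \<Rightarrow> real"
  assumes p: "\<And>n. p n > 0" "p sums 1"
    and u_def: "u = (\<lambda>k. \<Sum>n. (1 / real (Suc n)) ^ k * p n)"
begin

lemma moment_sums: "(\<lambda>n. (1 / real (Suc n)) ^ k * p n) sums u k"
proof -
  have "summable (\<lambda>n. (1 / real (Suc n)) ^ k * p n)"
    using p by (intro summable_comparison_test'[OF sums_summable[OF p(2)], of 0])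
      (auto simp: abs_mult less_imp_le power_le_one intro!: mult_left_le_one_le)
  then show ?thesis unfolding u_def by (rule summable_sums)
qed

lemma moment_0: "u 0 = 1"
  using moment_sums[of 0] p(2) by (simp add: sums_iff)

lemma moment_pos: "u k > 0"
proof -
  have "0 < (\<Sum>n. (1 / real (Suc n)) ^ k * p n)"
    using moment_sums[of k] p(1) by (intro suminf_pos) (auto simp: sums_iff simp del: of_nat_Suc)
  then show ?thesis using moment_sums[of k] by (simp add: sums_iff)
qed

lemma moment_strict_decreasing: "u (Suc k) < u k"
proof -
  have "(\<lambda>n. (1 / real (Suc n)) ^ k * p n - (1 / real (Suc n)) ^ Suc k * p n) sums (u k - u (Suc k))"
    by (intro sums_diff moment_sums)
  moreover have "(1 / real (Suc n)) ^ k * p n - (1 / real (Suc n)) ^ Suc k * p n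
      = (1 / real (Suc n)) ^ k * p n * (1 - 1 / real (Suc n))" for n
    by (simp add: algebra_simps)
  \<comment> \<open>The atom at \<open>1\<close> contributes nothing; strictness comes from the atom at \<open>1 / 2\<close>.\<close>
  moreover have "0 < (\<Sum>n. (1 / real (Suc n)) ^ k * p n * (1 - 1 / real (Suc n)))"
    using calculation p(1) by (intro suminf_pos2[of _ 1]) (auto simp: sums_iff less_imp_le intro!: mult_nonneg_nonneg)
  ultimately show ?thesis by (simp add: sums_iff)
qed

text \<open>Cauchy--Schwarz: the moment of order \<open>k\<close> of the nonnegative function \<open>(x - t)\<^sup>2\<close>, taken at the
  minimizing \<open>t = u (k + 1) / u k\<close>.\<close>

lemma moment_logconvex: "(u (Suc k))\<^sup>2 \<le> u k * u (Suc (Suc k))"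
proof -
  define t where "t = u (Suc k) / u k"
  have "(\<lambda>n. (1 / real (Suc n)) ^ Suc (Suc k) * p n - 2 * t * ((1 / real (Suc n)) ^ Suc k * p n)
      + t\<^sup>2 * ((1 / real (Suc n)) ^ k * p n)) sums (u (Suc (Suc k)) - 2 * t * u (Suc k) + t\<^sup>2 * u k)"
    by (intro sums_add sums_diff sums_mult moment_sums)
  moreover have "(1 / real (Suc n)) ^ Suc (Suc k) * p n - 2 * t * ((1 / real (Suc n)) ^ Suc k * p n)
      + t\<^sup>2 * ((1 / real (Suc n)) ^ k * p n) = (1 / real (Suc n)) ^ k * p n * (1 / real (Suc n) - t)\<^sup>2" for n
    by (simp add: algebra_simps power2_eq_square)
  ultimately have "0 \<le> u (Suc (Suc k)) - 2 * t * u (Suc k) + t\<^sup>2 * u k"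
    using p(1) by (metis (no_types, lifting) less_imp_le mult_nonneg_nonneg of_nat_0_le_iff
        divide_nonneg_nonneg zero_le_one zero_le_power zero_le_power2 suminf_nonneg sums_summable sums_unique)
  also have "\<dots> = u (Suc (Suc k)) - (u (Suc k))\<^sup>2 / u k"
    using moment_pos[of k] by (simp add: t_def field_simps power2_eq_square)
  finally show ?thesis using moment_pos[of k] by (simp add: field_simps)
qed

lemma moment_ge: "p 0 \<le> u k"
proof -
  have "(\<Sum>n\<in>{0}. (1 / real (Suc n)) ^ k * p n) \<le> (\<Sum>n. (1 / real (Suc n)) ^ k * p n)"
    using moment_sums[of k] p(1) by (intro sum_le_suminf) (auto simp: sums_iff less_imp_le)
  then show ?thesis using moment_sums[of k] by (simp add: sums_iff)
qed

text \<open>Subtracting \<open>p 0\<close> removes the atom at \<open>1\<close>. The geometric series at the atom \<open>1 / (n + 2)\<close>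
  has the sum \<open>(n + 2) / (n + 1) = 1 + 1 / (n + 1)\<close>.\<close>

lemma moment_excess_sums:
  assumes D: "(\<lambda>n. p (Suc n) * (1 + 1 / real (Suc n))) sums D"
  shows "(\<lambda>k. u k - p 0) sums D"
proof -
  define a where "a = (\<lambda>n k. p (Suc n) * (1 / real (Suc (Suc n))) ^ k)"
  have rows: "a n sums (p (Suc n) * (1 + 1 / real (Suc n)))" for n
  proof -
    have "a n sums (p (Suc n) * (1 / (1 - 1 / real (Suc (Suc n)))))"
      unfolding a_def by (intro sums_mult geometric_sums) simp
    also have "1 / (1 - 1 / real (Suc (Suc n))) = 1 + 1 / real (Suc n)"
      by (simp add: field_simps)
    finally show ?thesis .
  qed
  have cols: "(\<lambda>n. a n k) sums (u k - p 0)" for k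
    unfolding a_def mult.commute[of "p _"]
    using moment_sums[of k] by (subst sums_Suc_iff) simp
  have "(\<lambda>k. \<Sum>n. a n k) sums (\<Sum>n. \<Sum>k. a n k)"
  proof (rule double_series_swap)
    show "(\<lambda>k. norm (a n k)) sums (p (Suc n) * (1 + 1 / real (Suc n)))" for n
      using rows[of n] p(1)[of "Suc n"] by (simp add: a_def abs_mult less_imp_le)
  qed (use D in \<open>rule sums_summable\<close>)
  then show ?thesis using rows cols D by (simp add: sums_iff)
qed

lemma moment_generating_function:
  fixes z :: complex
  assumes z: "norm z < 1"
  shows "summable (\<lambda>k. norm (of_real (u k) * z ^ k))"
    and "(\<lambda>n. of_real (p n) / (1 - z / of_nat (Suc n))) sums (\<Sum>k. of_real (u k) * z ^ k)"
proof -
  have le1: "norm (u k) \<le> 1" for k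
  proof -
    have "decseq u" using moment_strict_decreasing by (intro decseq_SucI less_imp_le)
    then show ?thesis using moment_pos[of k] decseqD[of u 0 k] by (simp add: moment_0)
  qed
  show su: "summable (\<lambda>k. norm (of_real (u k) * z ^ k))"
    using z le1 by (intro summable_comparison_test'[OF summable_geometric[of "norm z"], of 0])
      (auto simp: norm_mult norm_power mult_left_le_one_le)
  define a where "a = (\<lambda>n k. of_real (p n) * (z / of_nat (Suc n)) ^ k)"
  note le = norm_divide_Suc_le[of z]
  have rows: "a n sums (of_real (p n) * (1 / (1 - z / of_nat (Suc n))))" for n
    unfolding a_def by (intro sums_mult geometric_sums order_le_less_trans[OF le z])
  have nrows: "(\<lambda>k. norm (a n k)) sums (p n * (1 / (1 - norm (z / of_nat (Suc n)))))" for n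
  proof -
    have "(\<lambda>k. p n * norm (z / of_nat (Suc n)) ^ k) sums (p n * (1 / (1 - norm (z / of_nat (Suc n)))))"
      using order_le_less_trans[OF le z, of n] by (intro sums_mult geometric_sums) simp
    then show ?thesis using p(1)[of n] by (simp add: a_def norm_mult norm_power less_imp_le)
  qed
  have cols: "(\<lambda>n. a n k) sums (of_real (u k) * z ^ k)" for k
  proof -
    have "(\<lambda>n. of_real ((1 / real (Suc n)) ^ k * p n) * z ^ k) sums (of_real (u k) * z ^ k)"
      by (intro sums_mult2 sums_of_real moment_sums)
    then show ?thesis by (simp add: a_def power_divide mult_ac)
  qed
  have sR: "summable (\<lambda>n. p n * (1 / (1 - norm (z / of_nat (Suc n)))))"
  proof (rule summable_comparison_test')
    show "summable (\<lambda>n. p n * (1 / (1 - norm z)))"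
      using p(2) by (intro summable_mult2) (rule sums_summable)
    fix n :: nat
    have "1 / (1 - norm (z / of_nat (Suc n))) \<le> 1 / (1 - norm z)"
      using z le[of n] by (intro frac_le) auto
    then show "norm (p n * (1 / (1 - norm (z / of_nat (Suc n))))) \<le> p n * (1 / (1 - norm z))"
      using p(1)[of n] order_le_less_trans[OF le z, of n] mult_left_mono[of _ _ "p n"]
      by (simp add: abs_mult less_imp_le del: of_nat_Suc times_divide_eq_right)
  qed
  have "(\<lambda>k. \<Sum>n. a n k) sums (\<Sum>n. \<Sum>k. a n k)"
    by (rule double_series_swap[OF nrows sR])
  then have "(\<Sum>n. of_real (p n) / (1 - z / of_nat (Suc n))) = (\<Sum>k. of_real (u k) * z ^ k)"
    using rows cols by (simp add: sums_iff del: of_nat_Suc)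
  moreover have "summable (\<lambda>n. of_real (p n) / (1 - z / of_nat (Suc n)))"
  proof (rule summable_comparison_test'[OF sR])
    fix n :: nat
    have "norm (1 - z / of_nat (Suc n)) \<ge> 1 - norm (z / of_nat (Suc n))"
      using norm_triangle_ineq2[of 1 "z / of_nat (Suc n)"] by simp
    then have "inverse (norm (1 - z / of_nat (Suc n))) \<le> inverse (1 - norm (z / of_nat (Suc n)))"
      using order_le_less_trans[OF le z, of n] by (intro le_imp_inverse_le) auto
    from mult_left_mono[OF this, of "p n"]
    show "norm (of_real (p n) / (1 - z / of_nat (Suc n))) \<le> p n * (1 / (1 - norm (z / of_nat (Suc n))))"
      using p(1)[of n]
      by (simp add: norm_mult norm_inverse divide_inverse less_imp_le del: of_nat_Suc)
  qed
  ultimately show "(\<lambda>n. of_real (p n) / (1 - z / of_nat (Suc n))) sums (\<Sum>k. of_real (u k) * z ^ k)"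
    by (simp add: sums_iff)
qed

end

section \<open>Reciprocals of a quadratic function\<close>

lemma quad_vieta:
  assumes roots: "\<And>z::complex. quad a b c z = of_real a * (z - r1) * (z - r2)"
  shows "of_real b + of_real a * (r1 + r2) = 0" and "of_real c = of_real a * r1 * r2"
  using roots[of 0] roots[of 1] by (simp_all add: quad_def algebra_simps)

lemma quad_of_real: "quad a b c (complex_of_real x) = of_real (quad a b c x)"
  by (simp add: quad_def)

text \<open>With \<open>U z = (\<Sum>n. p n / (1 - z / n))\<close>, each term obeys the partial fraction identity
  \<open>q(z) * p n / (1 - z / n) = c * p n + b * z * p n + c * z * p n / n - z * (1 / n - 1 / (n - z))\<close>.
  The first three summands add up to moments and the last one to a digamma series.\<close>

lemma quad_generating_function:
  fixes z :: complex
  assumes pos: "\<And>n::nat. n \<ge> 1 \<Longrightarrow> quad a b c (real n) > 0"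
    and pq: "p = (\<lambda>n. 1 / quad a b c (real (Suc n)))" and p1: "p sums 1"
    and u: "u = (\<lambda>k. \<Sum>n. (1 / real (Suc n)) ^ k * p n)" and z: "norm z < 1"
  shows "quad a b c z * (\<Sum>k. of_real (u k) * z ^ k)
    = of_real (c * u 0) + of_real (b * u 0 + c * u 1) * z - z * (euler_mascheroni + Digamma (1 - z))"
proof -
  interpret harmonic_moments p u
    by unfold_locales (use pos[of "Suc _"] p1 in \<open>simp_all add: pq u\<close>)
  have nz: "of_nat (Suc n) - z \<noteq> 0" for n
  proof
    assume "of_nat (Suc n) - z = 0"
    then have "z = of_nat (Suc n)" by simp
    then have "norm z = real (Suc n)" by (metis norm_of_nat)
    then show False using z by simp
  qed
  have dig: "(\<lambda>n. 1 / of_nat (Suc n) - 1 / (of_nat (Suc n) - z)) sums (Digamma (1 - z) + euler_mascheroni)"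
    using nz by (intro Digamma_sums_shifted) auto
  have m0: "(\<lambda>n. complex_of_real (p n)) sums of_real (u 0)"
    using sums_of_real[OF moment_sums[of 0]] by simp
  have m1: "(\<lambda>n. complex_of_real (p n / real (Suc n))) sums of_real (u 1)"
    using sums_of_real[OF moment_sums[of 1], where 'a = complex] by simp
  have "(\<lambda>n. of_real c * complex_of_real (p n) + (of_real b * z * complex_of_real (p n)
      + of_real c * z * complex_of_real (p n / real (Suc n)))
      - z * (1 / of_nat (Suc n) - 1 / (of_nat (Suc n) - z)))
    sums (of_real c * of_real (u 0) + (of_real b * z * of_real (u 0) + of_real c * z * of_real (u 1))
      - z * (Digamma (1 - z) + euler_mascheroni))"
    by (intro sums_add sums_diff sums_mult m0 m1 dig)
  moreover have "of_real c * complex_of_real (p n) + (of_real b * z * complex_of_real (p n)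
      + of_real c * z * complex_of_real (p n / real (Suc n)))
      - z * (1 / of_nat (Suc n) - 1 / (of_nat (Suc n) - z))
      = quad a b c z * (of_real (p n) / (1 - z / of_nat (Suc n)))" for n
  proof -
    define N where "N = complex_of_nat (Suc n)"
    define A B C where "A = complex_of_real a" "B = complex_of_real b" "C = complex_of_real c"
    have N: "N \<noteq> 0" "N - z \<noteq> 0" using nz[of n] by (simp_all add: N_def del: of_nat_Suc)
    have pn: "complex_of_real (p n) = 1 / (A * N\<^sup>2 + B * N + C)"
      by (simp add: pq quad_def N_def A_B_C_def)
    have "complex_of_real (quad a b c (real (Suc n))) \<noteq> 0"
      using pos[of "Suc n"] by (metis le_add1 less_irrefl of_real_eq_0_iff plus_1_eq_Suc)
    then have qn: "A * N\<^sup>2 + B * N + C \<noteq> 0"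
      by (simp add: quad_def N_def A_B_C_def)
    have pn1: "complex_of_real (p n / real (Suc n)) = 1 / (A * N\<^sup>2 + B * N + C) / N"
      by (simp add: pn N_def del: of_nat_Suc)
    define P where "P = 1 / (A * N\<^sup>2 + B * N + C)"
    have P: "P * (A * N\<^sup>2 + B * N + C) = 1" using qn by (simp add: P_def)
    \<comment> \<open>Multiplied by \<open>P * q(N) = 1\<close>, the digamma term gets the common factor \<open>P\<close>; what is left is a
      polynomial identity.\<close>
    have "z * (z / (N * (N - z))) = z * (z / (N * (N - z))) * (P * (A * N\<^sup>2 + B * N + C))"
      using P by simp
    also have "C * P + (B * z * P + C * z * (P / N)) + \<dots> = (A * z\<^sup>2 + B * z + C) * (P / (1 - z / N))
       \<longleftrightarrow> True"
      using N by (simp add: field_simps power2_eq_square)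
    finally have "C * P + (B * z * P + C * z * (P / N)) + z * (z / (N * (N - z)))
      = (A * z\<^sup>2 + B * z + C) * (P / (1 - z / N))"
      by simp
    moreover have "1 / N - 1 / (N - z) = - (z / (N * (N - z)))" using N by (simp add: field_simps)
    ultimately show ?thesis
      unfolding pn pn1 P_def[symmetric] N_def[symmetric] quad_def A_B_C_def[symmetric] by simp
  qed
  ultimately have "(\<lambda>n. quad a b c z * (of_real (p n) / (1 - z / of_nat (Suc n))))
    sums (of_real c * of_real (u 0) + (of_real b * z * of_real (u 0) + of_real c * z * of_real (u 1))
      - z * (Digamma (1 - z) + euler_mascheroni))" by simp
  moreover have "(\<lambda>n. quad a b c z * (of_real (p n) / (1 - z / of_nat (Suc n)))) sums
      (quad a b c z * (\<Sum>k. of_real (u k) * z ^ k))"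
    by (intro sums_mult moment_generating_function z)
  ultimately show ?thesis
    by (simp add: sums_iff algebra_simps)
qed

text \<open>The partial fraction identity
  \<open>2 * q(1) / (m * q(m + 1)) = (1 / m - 1 / (m + 1 - r1)) + (1 / m - 1 / (m + 1 - r2))
  - (2 * a + b) / q(m + 1)\<close> holds for simple and double roots alike. The sum of \<open>1 / q(m + 1)\<close> is
  \<open>1 - 1 / q(1)\<close> by the normalization. The statement keeps the factor \<open>2 * q(1)\<close> because this is how
  \<open>D\<close> enters the variance.\<close>

lemma quad_excess_Digamma:
  assumes pos: "\<And>n::nat. n \<ge> 1 \<Longrightarrow> quad a b c (real n) > 0"
    and p: "p = (\<lambda>n. 1 / quad a b c (real (Suc n)))" and p1: "p sums 1"
    and roots: "\<And>z::complex. quad a b c z = of_real a * (z - r1) * (z - r2)"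
  defines "Q \<equiv> quad a b c (1::real)"
  obtains D where "(\<lambda>n. p (Suc n) * (1 + 1 / real (Suc n))) sums D"
    and "2 * of_real Q * of_real D =
       2 * of_real Q - 2 + (Digamma (1 - r1) + Digamma (1 - r2)) + 2 * euler_mascheroni
       + of_real ((2 * a + b) * (2 / Q - 1))"
proof -
  have Q: "Q > 0" using pos[of 1] by (simp add: Q_def)
  have notroot: "quad a b c (complex_of_nat (Suc n)) \<noteq> 0" for n
  proof -
    have "quad a b c (complex_of_nat (Suc n)) = of_real (quad a b c (real (Suc n)))"
      by (simp add: quad_def)
    then show ?thesis using pos[of "Suc n"] by simp
  qed
  have nr: "r1 \<noteq> of_nat (Suc n)" "r2 \<noteq> of_nat (Suc n)" for n
    using notroot[of n] by (auto simp: roots simp del: of_nat_Suc)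
  have dig: "(\<lambda>n. 1 / of_nat (Suc n) - 1 / (of_nat (Suc (Suc n)) - r)) sums
      (Digamma (1 - r) + 1 / (1 - r) + euler_mascheroni)"
    if r: "\<And>n. r \<noteq> of_nat (Suc n)" for r :: complex
  proof -
    have "1 - r \<noteq> 0" using r[of 0] by auto
    then have "Digamma (1 - (r - 1)) = Digamma (1 - r) + 1 / (1 - r)"
      using Digamma_plus1[of "1 - r"] by (simp add: algebra_simps)
    moreover have "r - 1 \<notin> {s. \<exists>n::nat. s = of_nat (Suc n)}"
    proof
      assume "r - 1 \<in> {s. \<exists>n::nat. s = of_nat (Suc n)}"
      then obtain n where "r - 1 = of_nat (Suc n)" by auto
      then have "r = of_nat (Suc (Suc n))" by (simp add: algebra_simps)
      with r show False by blast
    qed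
    from Digamma_sums_shifted[OF this]
    have "(\<lambda>n. 1 / of_nat (Suc n) - 1 / (of_nat (Suc n) - (r - 1))) sums
        (Digamma (1 - (r - 1)) + euler_mascheroni)" .
    ultimately show ?thesis by (simp add: algebra_simps)
  qed
  have tail: "(\<lambda>n. complex_of_real (p (Suc n))) sums of_real (1 - 1 / Q)"
    using p1 by (intro sums_of_real, subst sums_Suc_iff) (simp add: p Q_def)
  define S where "S = (Digamma (1 - r1) + 1 / (1 - r1) + euler_mascheroni)
    + (Digamma (1 - r2) + 1 / (1 - r2) + euler_mascheroni)
    - of_real (2 * a + b) * of_real (1 - 1 / Q)"
  have "(\<lambda>n. (1 / of_nat (Suc n) - 1 / (of_nat (Suc (Suc n)) - r1))
    + (1 / of_nat (Suc n) - 1 / (of_nat (Suc (Suc n)) - r2))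
    - of_real (2 * a + b) * complex_of_real (p (Suc n))) sums S"
    unfolding S_def by (intro sums_add sums_diff sums_mult tail dig nr)
  moreover have "(1 / of_nat (Suc n) - 1 / (of_nat (Suc (Suc n)) - r1))
    + (1 / of_nat (Suc n) - 1 / (of_nat (Suc (Suc n)) - r2))
    - of_real (2 * a + b) * complex_of_real (p (Suc n)) = of_real (2 * Q * (p (Suc n) / real (Suc n)))" for n
  proof -
    define m where "m = complex_of_nat (Suc n)"
    define A where "A = complex_of_real a"
    have m: "m \<noteq> 0" by (simp add: m_def del: of_nat_Suc)
    have d: "m + 1 - r1 \<noteq> 0" "m + 1 - r2 \<noteq> 0"
      using nr[of "Suc n"] by (auto simp: m_def algebra_simps)
    have pn: "complex_of_real (p (Suc n)) = 1 / (A * (m + 1 - r1) * (m + 1 - r2))"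
      using roots[of "of_nat (Suc (Suc n))"] by (simp add: p quad_def m_def A_def algebra_simps)
    have A: "A \<noteq> 0" using notroot[of 0] by (auto simp: roots A_def)
    have QA: "complex_of_real Q = A * (1 - r1) * (1 - r2)"
      using roots[of 1] by (simp add: Q_def quad_def A_def)
    have BA: "of_real (2 * a + b) = A * (2 - r1 - r2)"
      using quad_vieta(1)[OF roots] by (simp add: A_def algebra_simps add_eq_0_iff)
    have "(1 / m - 1 / (m + 1 - r1)) + (1 / m - 1 / (m + 1 - r2)) 
      - A * (2 - r1 - r2) * (1 / (A * (m + 1 - r1) * (m + 1 - r2)))
      = 2 * (A * (1 - r1) * (1 - r2)) * (1 / (A * (m + 1 - r1) * (m + 1 - r2)) / m)"
      using m d A by (simp add: divide_simps) (simp add: algebra_simps)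
    then show ?thesis unfolding of_real_mult of_real_divide pn QA BA
      by (simp add: m_def add_ac)
  qed
  ultimately have S: "(\<lambda>n. complex_of_real (2 * Q * (p (Suc n) / real (Suc n)))) sums S" by simp
  then have Re: "(\<lambda>n. 2 * Q * (p (Suc n) / real (Suc n))) sums Re S"
    using sums_Re by fastforce
  have SR: "S = of_real (Re S)"
    using S sums_of_real[OF Re] by (rule sums_unique2)
  \<comment> \<open>The shift from \<open>Digamma (2 - r)\<close> to \<open>Digamma (1 - r)\<close> at both roots costs \<open>q'(1) / q(1)\<close>.\<close>
  have r: "1 / (1 - r1) + 1 / (1 - r2) = of_real ((2 * a + b) / Q)"
  proof -
    have "1 - r1 \<noteq> 0" "1 - r2 \<noteq> 0" using nr[of 0] by auto
    moreover have "complex_of_real a \<noteq> 0" using notroot[of 0] by (auto simp: roots)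
    moreover have "complex_of_real Q = of_real a * (1 - r1) * (1 - r2)"
      using roots[of 1] by (simp add: Q_def quad_def)
    moreover have "of_real (2 * a + b) = of_real a * (2 - r1 - r2)"
      using quad_vieta(1)[OF roots] by (simp add: algebra_simps add_eq_0_iff)
    ultimately show ?thesis unfolding of_real_divide by (simp add: divide_simps)
  qed
  show thesis
  proof (rule that)
    have "(\<lambda>n. p (Suc n)) sums (1 - 1 / Q)"
      using p1 by (subst sums_Suc_iff) (simp add: p Q_def)
    from sums_add[OF this sums_mult[OF Re, of "1 / (2 * Q)"]]
    show "(\<lambda>n. p (Suc n) * (1 + 1 / real (Suc n))) sums (1 - 1 / Q + 1 / (2 * Q) * Re S)"
      using Q by (simp add: algebra_simps)
    have "2 * complex_of_real Q * of_real (1 - 1 / Q + 1 / (2 * Q) * Re S) =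
        of_real (2 * Q - 2) + of_real (Re S)"
      using Q by (simp add: field_simps)
    also have "of_real (Re S) = S" using SR by simp
    finally have F: "2 * complex_of_real Q * of_real (1 - 1 / Q + 1 / (2 * Q) * Re S) =
        of_real (2 * Q - 2) + S" .
    have "S = (Digamma (1 - r1) + Digamma (1 - r2)) + 2 * euler_mascheroni
        + (1 / (1 - r1) + 1 / (1 - r2)) - of_real ((2 * a + b) * (1 - 1 / Q))"
      unfolding S_def of_real_mult by (simp add: algebra_simps)
    also have "\<dots> = (Digamma (1 - r1) + Digamma (1 - r2)) + 2 * euler_mascheroni
        + of_real ((2 * a + b) * (2 / Q - 1))"
      unfolding r using Q by (simp add: field_simps)
    finally have S_eq: "S = (Digamma (1 - r1) + Digamma (1 - r2)) + 2 * euler_mascheroni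
        + of_real ((2 * a + b) * (2 / Q - 1))" .
    show "2 * complex_of_real Q * of_real (1 - 1 / Q + 1 / (2 * Q) * Re S) =
       2 * of_real Q - 2 + (Digamma (1 - r1) + Digamma (1 - r2)) + 2 * euler_mascheroni
       + of_real ((2 * a + b) * (2 / Q - 1))"
      unfolding F by (subst S_eq) (simp only: of_real_diff of_real_mult of_real_numeral of_real_1 add.assoc)
  qed
qed

section \<open>The renewal sequence of a quadratic function\<close>

theorem proposition4p1:
  fixes a b c :: real and r1 r2 :: complex
    and u :: "nat \<Rightarrow> real" and U G :: "complex \<Rightarrow> complex"
  assumes "a \<noteq> 0"
    and "\<And>n::nat. n \<ge> 1 \<Longrightarrow> quad a b c (real n) > 0"
    and "(\<lambda>n. 1 / quad a b c (real (Suc n))) sums 1"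
    and "\<And>z::complex. quad a b c z = of_real a * (z - r1) * (z - r2)"
    and u: "u = quad_seq a b c"
    and U: "U = (\<lambda>z. \<Sum>k. of_real (u k) * z ^ k)"
    and G: "G = (\<lambda>z. - z * (euler_mascheroni + Digamma (1 - z)))"
  shows "(\<forall>k. u (Suc k) < u k) \<and>
    renewal_sequence u \<and> positive_recurrent u \<and>
    u \<longlonglongrightarrow> 1 / quad a b c (1::real) \<and>
    (\<exists>(M :: (nat \<Rightarrow> nat) measure) Y. renewal_steps M Y u) \<and>
    (\<forall>(M :: 'm measure) Y. renewal_steps M Y u \<longrightarrow>
       renewal_law (\<lambda>k. measure M {\<omega> \<in> space M. Y 1 \<omega> = k}) u \<and>
       integrable M (\<lambda>\<omega>. real (Y 1 \<omega>)) \<and>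
       prob_space.expectation M (\<lambda>\<omega>. real (Y 1 \<omega>)) = quad a b c (1::real) \<and>
       integrable M (\<lambda>\<omega>. (real (Y 1 \<omega>))\<^sup>2) \<and>
       complex_of_real (prob_space.variance M (\<lambda>\<omega>. real (Y 1 \<omega>))) =
         (4 - quad a b c 1) * of_real a - quad a b c (- 1) +
         quad a b c 1 * (of_real c + 2 * euler_mascheroni + Digamma (1 - r1) + Digamma (1 - r2)) \<and>
       (\<forall>z::complex. norm z < 1 \<longrightarrow>
          integrable M (\<lambda>\<omega>. z ^ Y 1 \<omega>) \<and> U z \<noteq> 0 \<and>
          prob_space.expectation M (\<lambda>\<omega>. z ^ Y 1 \<omega>) = 1 - 1 / U z)) \<and>
    (\<forall>z::complex. norm z < 1 \<longrightarrow> summable (\<lambda>k. of_real (u k) * z ^ k)) \<and>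
    (\<forall>z::complex. norm z < 1 \<longrightarrow>
       (\<lambda>n. of_real (zeta_nat (n + 2)) * z ^ (n + 2)) sums G z) \<and>
    U holomorphic_on ball 0 1 \<and>
    (\<forall>z::complex. norm z < 1 \<and> quad a b c z \<noteq> 0 \<longrightarrow>
       U z = (of_real (c * u 0) + of_real (b * u 0 + c * u 1) * z + G z) / quad a b c z)"
proof -
  define p where "p = (\<lambda>n. 1 / quad a b c (real (Suc n)))"
  define Q where "Q = quad a b c (1::real)"
  have Q: "Q > 0" using assms(2)[of 1] by (simp add: Q_def)
  have p1: "p sums 1" using assms(3) by (simp add: p_def)
  have p0: "p 0 = 1 / Q" by (simp add: p_def Q_def)
  have u_eq: "u = (\<lambda>k. \<Sum>n. (1 / real (Suc n)) ^ k * p n)"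
    by (simp add: u quad_seq_def p_def fun_eq_iff)
  interpret harmonic_moments p u
  proof
    show "p n > 0" for n using assms(2)[of "Suc n"] by (simp add: p_def)
    show "p sums 1" by (rule p1)
    show "u = (\<lambda>k. \<Sum>n. (1 / real (Suc n)) ^ k * p n)" by (rule u_eq)
  qed
  obtain D where Dsum: "(\<lambda>n. p (Suc n) * (1 + 1 / real (Suc n))) sums D"
    and D: "2 * of_real Q * of_real D =
       2 * of_real Q - 2 + (Digamma (1 - r1) + Digamma (1 - r2)) + 2 * euler_mascheroni
       + of_real ((2 * a + b) * (2 / Q - 1))"
    by (rule quad_excess_Digamma[OF assms(2) p_def p1 assms(4), folded Q_def])
  have excess: "(\<lambda>k. u k - 1 / Q) sums D" using moment_excess_sums[OF Dsum] by (simp add: p0)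
  have ge: "1 / Q \<le> u k" for k using moment_ge[of k] by (simp add: p0)
  have lim: "u \<longlonglongrightarrow> 1 / Q"
    using summable_LIMSEQ_zero[OF sums_summable[OF excess]] by (simp add: LIM_zero_iff)
  have moments: "(\<lambda>k. g (Suc k)) sums 1" "(\<lambda>k. real (Suc k) * g (Suc k)) sums Q"
    "(\<lambda>k. (real (Suc k))\<^sup>2 * g (Suc k)) sums (Q + 2 * D * Q\<^sup>2)"
    if g: "renewal_law g u" for g
    using renewal_moments[of u g "1 / Q" D] g moment_0 Q ge excess
    by (simp_all add: renewal_law_def power_divide)
  obtain f where rec: "\<And>k. k \<ge> 1 \<Longrightarrow> u k = (\<Sum>j=1..k. f j * u (k - j))"
    using renewal_equation_solvable[of u] moment_0 by blast
  have f: "f k \<ge> 0" if "k \<ge> 1" for k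
    by (rule renewal_weights_nonneg_if_logconvex[OF moment_0 moment_pos moment_logconvex rec that])
  have f1: "(\<lambda>k. f (Suc k)) sums 1"
    using renewal_moments(1)[OF moment_0 rec f _ ge excess] Q by simp
  have law: "renewal_law f u"
    using f f1 moment_0 rec by (auto simp: renewal_law_def sums_iff)
  have "positive_recurrent u"
    unfolding positive_recurrent_def using law moments[OF law] by (auto dest: sums_summable)
  moreover have "\<exists>(M :: (nat \<Rightarrow> nat) measure) Y. renewal_steps M Y u"
    using renewal_steps_exist[OF f f1 moment_0 rec] .
  moreover have "renewal_law (\<lambda>k. measure M {\<omega> \<in> space M. Y 1 \<omega> = k}) u \<and>
       integrable M (\<lambda>\<omega>. real (Y 1 \<omega>)) \<and>
       prob_space.expectation M (\<lambda>\<omega>. real (Y 1 \<omega>)) = quad a b c (1::real) \<and>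
       integrable M (\<lambda>\<omega>. (real (Y 1 \<omega>))\<^sup>2) \<and>
       complex_of_real (prob_space.variance M (\<lambda>\<omega>. real (Y 1 \<omega>))) =
         (4 - quad a b c 1) * of_real a - quad a b c (- 1) +
         quad a b c 1 * (of_real c + 2 * euler_mascheroni + Digamma (1 - r1) + Digamma (1 - r2)) \<and>
       (\<forall>z::complex. norm z < 1 \<longrightarrow>
          integrable M (\<lambda>\<omega>. z ^ Y 1 \<omega>) \<and> U z \<noteq> 0 \<and>
          prob_space.expectation M (\<lambda>\<omega>. z ^ Y 1 \<omega>) = 1 - 1 / U z)"
    if steps: "renewal_steps M Y u" for M :: "'m measure" and Y
  proof -
    define g where "g = (\<lambda>k. measure M {\<omega> \<in> space M. Y 1 \<omega> = k})"
    note st = renewal_steps_law[OF steps, folded g_def]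
    interpret prob_space M by (rule st(1))
    have g0: "g 0 = 0" "\<And>k. g k \<ge> 0" using st(3) by (simp_all add: g_def)
    have g: "g sums 1" "(\<lambda>k. g k * real k) sums Q" "(\<lambda>k. g k * (real k)\<^sup>2) sums (Q + 2 * D * Q\<^sup>2)"
      using moments[OF st(4), THEN sums_Suc] g0 by (simp_all add: mult.commute)
    have e: "integrable M (\<lambda>\<omega>. real (Y 1 \<omega>))" "expectation (\<lambda>\<omega>. real (Y 1 \<omega>)) = Q"
      using expectation_nat_valued[OF st(2), of real] g(2) unfolding g_def by (simp_all add: sums_iff)
    have e2: "integrable M (\<lambda>\<omega>. (real (Y 1 \<omega>))\<^sup>2)" "expectation (\<lambda>\<omega>. (real (Y 1 \<omega>))\<^sup>2) = Q + 2 * D * Q\<^sup>2"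
      using expectation_nat_valued[OF st(2), of "\<lambda>k. (real k)\<^sup>2"] g(3) unfolding g_def by (simp_all add: sums_iff)
    have "variance (\<lambda>\<omega>. real (Y 1 \<omega>)) = Q - Q\<^sup>2 + 2 * D * Q\<^sup>2"
      using variance_eq[OF e(1) e2(1)] by (simp only: e(2) e2(2))
    then have "complex_of_real (variance (\<lambda>\<omega>. real (Y 1 \<omega>))) =
        of_real Q - of_real Q ^ 2 + of_real Q * (2 * of_real Q * of_real D)"
      by (simp add: power2_eq_square)
    also have "\<dots> = of_real (Q - Q ^ 2 + Q * (2 * Q - 2) + Q * ((2 * a + b) * (2 / Q - 1)))
       + of_real Q * (2 * euler_mascheroni + Digamma (1 - r1) + Digamma (1 - r2))"
      unfolding D by (simp add: ring_distribs)
    also have "Q - Q ^ 2 + Q * (2 * Q - 2) + Q * ((2 * a + b) * (2 / Q - 1))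
       = (4 - Q) * a - quad a b c (- 1) + Q * c"
    proof -
      have "Q * ((2 * a + b) * (2 / Q - 1)) = (2 * a + b) * (2 - Q)" using Q by (simp add: field_simps)
      moreover have "quad a b c (- 1) = a - b + c" "Q = a + b + c" by (simp_all add: quad_def Q_def)
      ultimately show ?thesis by (simp add: power2_eq_square algebra_simps)
    qed
    also have "of_real \<dots> + of_real Q * (2 * euler_mascheroni + Digamma (1 - r1) + Digamma (1 - r2))
       = (4 - quad a b c 1) * of_real a - quad a b c (- 1) +
         quad a b c 1 * (of_real c + 2 * euler_mascheroni + Digamma (1 - r1) + Digamma (1 - r2))"
      using quad_of_real[of a b c 1] quad_of_real[of a b c "- 1"] by (simp add: Q_def algebra_simps)
    finally have var: "complex_of_real (variance (\<lambda>\<omega>. real (Y 1 \<omega>))) =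
         (4 - quad a b c 1) * of_real a - quad a b c (- 1) +
         quad a b c 1 * (of_real c + 2 * euler_mascheroni + Digamma (1 - r1) + Digamma (1 - r2))" .
    have gen: "integrable M (\<lambda>\<omega>. z ^ Y 1 \<omega>) \<and> U z \<noteq> 0 \<and> expectation (\<lambda>\<omega>. z ^ Y 1 \<omega>) = 1 - 1 / U z"
      if z: "norm z < 1" for z :: complex
    proof -
      have sg: "summable (\<lambda>k. g k * norm (z ^ k))"
        using z g0 by (intro summable_comparison_test'[OF sums_summable[OF g(1)], of 0])
          (auto simp: norm_power power_le_one mult_left_le)
      have recg: "\<And>k. k \<ge> 1 \<Longrightarrow> u k = (\<Sum>j=1..k. g j * u (k - j))"
        using st(4) by (simp add: renewal_law_def)
      have "summable (\<lambda>k. norm (of_real (g k) * z ^ k))"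
        using sg g0(2) by (simp add: norm_mult)
      note gf = renewal_generating_function[where u = u and f = g and z = z,
          OF moment_0 recg g0(1) this moment_generating_function(1)[OF z]]
      have "U z \<noteq> 0" "(\<Sum>k. of_real (g k) * z ^ k) = 1 - 1 / U z"
        unfolding U using gf by auto
      then show ?thesis
        using expectation_nat_valued[OF st(2), of "\<lambda>k. z ^ k"] sg
        unfolding g_def by (simp add: scaleR_conv_of_real)
    qed
    show ?thesis using st(4) e e2 var gen by (simp add: g_def Q_def)
  qed
  moreover have su: "summable (\<lambda>k. of_real (u k) * z ^ k)" if "norm z < 1" for z :: complex
    using moment_generating_function(1)[OF that] by (rule summable_norm_cancel)
  moreover have "U holomorphic_on ball 0 1"
    using su by (intro power_series_holomorphic[where a = "\<lambda>k. of_real (u k)"])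
      (auto simp: U intro!: summable_sums)
  moreover have "U z = (of_real (c * u 0) + of_real (b * u 0 + c * u 1) * z + G z) / quad a b c z"
    if "norm z < 1" "quad a b c z \<noteq> 0" for z :: complex
    using quad_generating_function[OF assms(2) p_def p1 u_eq that(1)] that(2)
    by (simp add: U G field_simps)
  ultimately show ?thesis
    using moment_strict_decreasing lim law zeta_generating_function
    unfolding renewal_sequence_def Q_def G by blast
qed

end
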